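(* Let $\alpha>0$ and suppose the knockoff statistics $\mathbf w_1,\dots,\mathbf w_m$ satisfy the null sign-flip property. Then the closed knockoffs collection is given by $$\boldsymbol{\mathcal R}^{\overline{\mathrm{Kn}}}_\alpha=\Big\{R\subseteq[m]:\ \mathbf w_i\ge\mathbf c_\alpha\text{ for all }i\in R\ \text{ and }\ \frac{|R|}{1+\sum_{j\in[m]}\mathbf 1\{\mathbf w_j\le-\mathbf c_\alpha\}}\ge\frac1\alpha\Big\}\cup\{\emptyset\}.$$
   Context: Setting: $M$ is a set of probability measures on a measurable space; $m\ge 1$, $[m]=\{1,\dots,m\}$; hypotheses $H_1,\dots,H_m\subseteq M$; $N_{\mathrm P}=\{i\in[m]:\mathrm P\in H_i\}$. $\mathrm{FDP}_S(R)=|R\cap S|/(|R|\vee1)$. $\mathbf w_1,\dots,\mathbf w_m$ are real-valued random variables (knockoff statistics). Null sign-flip property: for every $\mathrm P\in M$, if $\varepsilon_i$, $i\in N_{\mathrm P}$, are i.i.d. uniform on $\{-1,+1\}$ independent of $\mathbf w$ and $\varepsilon_i=1$ for $i\notin N_{\mathrm P}$, then $(\varepsilon_i\mathbf w_i)_{i\in[m]}$ has the same distribution as $(\mathbf w_i)_{i\in[m]}$ under $\mathrm P$. The knockoff threshold is $$\mathbf c_\alpha=\min\Big\{c\in\{|\mathbf w_i|:|\mathbf w_i|>0\}:\ \frac{1+\sum_{i\in[m]}\mathbf 1\{\mathbf w_i\le-c\}}{\sum_{i\in[m]}\mathbf 1\{\mathbf w_i\ge c\}}\le\alpha\Big\},$$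 with the minimum of the empty set equal to $+\infty$ (and a ratio with zero denominator counted as $+\infty$). Local e-values: $\mathbf e_S=\dfrac{\sum_{i\in S}\mathbf 1\{\mathbf w_i\ge\mathbf c_\alpha\}}{1+\sum_{j\in S}\mathbf 1\{\mathbf w_j\le-\mathbf c_\alpha\}}$ for $S\subseteq[m]$. The closed knockoffs collection is $\boldsymbol{\mathcal R}^{\overline{\mathrm{Kn}}}_\alpha=\{R\in 2^{[m]}:\mathbf e_S\ge\mathrm{FDP}_S(R)/\alpha\text{ for all }S\in 2^{[m]}\}$. *)

theory Defs
  imports "HOL-Probability.Probability"
begin

definition FDP :: "nat set \<Rightarrow> nat set \<Rightarrow> real" where
  "FDP S R = real (card (R \<inter> S)) / real (max (card R) 1)"

definition null_indices :: "nat \<Rightarrow> (nat \<Rightarrow> 'a measure set) \<Rightarrow> 'a measure \<Rightarrow> nat set" where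
  "null_indices m H P = {i \<in> {1..m}. P \<in> H i}"

text \<open>The law of the sign vector: independent coordinates, uniform on \<open>{-1, 1}\<close> on \<open>N\<close>
  and constantly \<open>1\<close> off \<open>N\<close>.\<close>

definition null_signs :: "nat \<Rightarrow> nat set \<Rightarrow> (nat \<Rightarrow> real) pmf" where
  "null_signs m N =
     Pi_pmf {1..m} 1 (\<lambda>i. if i \<in> N then pmf_of_set {-1, 1} else return_pmf 1)"

text \<open>Independence of the signs from the statistics is expressed by enlarging the probability
  space \<open>P\<close> to its product with the law of the signs. The two sides are the joint laws of the
  sign-flipped and of the original vector, as measures on \<open>\<real>\<^sup>m\<close>.\<close>

definition null_sign_flip ::
  "'a measure set \<Rightarrow> nat \<Rightarrow> (nat \<Rightarrow> 'a measure set) \<Rightarrow> (nat \<Rightarrow> 'a \<Rightarrow> real) \<Rightarrow> bool" where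
  "null_sign_flip M m H w \<longleftrightarrow>
     (\<forall>P\<in>M.
        distr (P \<Otimes>\<^sub>M measure_pmf (null_signs m (null_indices m H P)))
              (Pi\<^sub>M {1..m} (\<lambda>_. borel)) (\<lambda>(\<omega>, \<epsilon>). \<lambda>i\<in>{1..m}. \<epsilon> i * w i \<omega>)
        = distr P (Pi\<^sub>M {1..m} (\<lambda>_. borel)) (\<lambda>\<omega>. \<lambda>i\<in>{1..m}. w i \<omega>))"

text \<open>The remaining definitions act on a realised vector \<open>v\<close> of knockoff statistics. In
  \<^typ>\<open>ereal\<close>, a positive number divided by \<open>0\<close> is \<open>\<infinity>\<close>.\<close>

definition knockoff_ratio :: "nat \<Rightarrow> (nat \<Rightarrow> real) \<Rightarrow> real \<Rightarrow> ereal" where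
  "knockoff_ratio m v c =
     ereal (1 + (\<Sum>i\<in>{1..m}. of_bool (v i \<le> - c))) / ereal (\<Sum>i\<in>{1..m}. of_bool (v i \<ge> c))"

definition knockoff_threshold :: "nat \<Rightarrow> real \<Rightarrow> (nat \<Rightarrow> real) \<Rightarrow> ereal" where
  "knockoff_threshold m \<alpha> v =
     (let C = {c \<in> {\<bar>v i\<bar> | i. i \<in> {1..m} \<and> \<bar>v i\<bar> > 0}. knockoff_ratio m v c \<le> ereal \<alpha>}
      in if C = {} then \<infinity> else ereal (Min C))"

definition local_evalue :: "nat \<Rightarrow> real \<Rightarrow> (nat \<Rightarrow> real) \<Rightarrow> nat set \<Rightarrow> real" where
  "local_evalue m \<alpha> v S =
     (\<Sum>i\<in>S. of_bool (ereal (v i) \<ge> knockoff_threshold m \<alpha> v)) /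
     (1 + (\<Sum>j\<in>S. of_bool (ereal (v j) \<le> - knockoff_threshold m \<alpha> v)))"

definition closed_knockoffs :: "nat \<Rightarrow> real \<Rightarrow> (nat \<Rightarrow> real) \<Rightarrow> nat set set" where
  "closed_knockoffs m \<alpha> v =
     {R \<in> Pow {1..m}. \<forall>S\<in>Pow {1..m}. local_evalue m \<alpha> v S \<ge> FDP S R / \<alpha>}"

end

(* The identity holds for every realised vector v of statistics; only positivity of the threshold
   matters, so that the sets A and B of coordinates above c and below -c are disjoint. A nonempty
   R in the collection is tested against the singletons of R, which forces R to lie in A, and against the
   union of R and B, where FDP is 1 and the e-value is card R / (1 + card B). Conversely, these two
   conditions give card (S Int A) / (1 + card (S Int B)) >= card (R Int S) / (1 + card B)
   for every S, and 1 + card B <= \<alpha> * card R. *)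

theory Submission
  imports Defs
begin

text \<open>The candidates are finitely many values \<open>\<bar>v i\<bar> > 0\<close>, so their
  minimum is itself a positive candidate; without candidates the threshold is
  \<open>\<infinity>\<close>.\<close>

lemma knockoff_threshold_pos: "0 < knockoff_threshold m \<alpha> v"
proof -
  let ?C = "{c \<in> {\<bar>v i\<bar> | i. i \<in> {1..m} \<and> \<bar>v i\<bar> > 0}. knockoff_ratio m v c \<le> ereal \<alpha>}"
  show ?thesis
  proof (cases "?C = {}")
    case True
    then show ?thesis unfolding knockoff_threshold_def Let_def by simp
  next
    case False
    have "finite ?C"
      by (rule finite_subset[where B = "(\<lambda>i. \<bar>v i\<bar>) ` {1..m}"]) auto
    then have "Min ?C \<in> ?C" using False by (rule Min_in)
    moreover have "c > 0" if "c \<in> ?C" for c using that by auto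
    ultimately have "0 < Min ?C" by meson
    then show ?thesis using False unfolding knockoff_threshold_def Let_def by simp
  qed
qed

lemma local_evalue_eq_card:
  assumes "finite S"
  shows "local_evalue m \<alpha> v S =
    real (card (S \<inter> {i. ereal (v i) \<ge> knockoff_threshold m \<alpha> v})) /
    (1 + real (card (S \<inter> {i. ereal (v i) \<le> - knockoff_threshold m \<alpha> v})))"
  using assms by (simp add: local_evalue_def)

text \<open>The empty set is excluded because it fails the ratio condition
  (\<open>0 < 1 / \<alpha>\<close>) although it belongs to the collection. For nonempty
  \<open>R\<close> the denominator of \<open>FDP S R\<close> is simply
  \<open>card R\<close>.\<close>

lemma closed_knockoffs_iff:
  assumes "\<alpha> > 0" and "R \<noteq> {}"
  shows "R \<in> closed_knockoffs m \<alpha> v \<longleftrightarrow>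
    R \<subseteq> {1..m} \<and> (\<forall>i\<in>R. ereal (v i) \<ge> knockoff_threshold m \<alpha> v) \<and>
    real (card R) / (1 + real (card ({1..m} \<inter> {j. ereal (v j) \<le> - knockoff_threshold m \<alpha> v})))
      \<ge> 1 / \<alpha>"
proof -
  define A where "A = {i. ereal (v i) \<ge> knockoff_threshold m \<alpha> v}"
  define B where "B = {i. ereal (v i) \<le> - knockoff_threshold m \<alpha> v}"
  define D where "D = {1..m} \<inter> B"
  have e: "local_evalue m \<alpha> v S = real (card (S \<inter> A)) / (1 + real (card (S \<inter> B)))"
    if "S \<subseteq> {1..m}" for S
    unfolding A_def B_def using that by (intro local_evalue_eq_card) (rule finite_subset, auto)
  have disj: "A \<inter> B = {}"
  proof -
    have False if "i \<in> A" "i \<in> B" for i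
    proof -
      \<comment> \<open>Here \<open>v i\<close> would lie between the threshold and its negative.
        Arguing in \<open>ereal\<close> also covers an infinite threshold.\<close>
      have "knockoff_threshold m \<alpha> v \<le> - knockoff_threshold m \<alpha> v"
        using that order_trans[of _ "ereal (v i)"] by (simp add: A_def B_def)
      moreover have "- knockoff_threshold m \<alpha> v < 0"
        using knockoff_threshold_pos[of m \<alpha> v] by (simp add: ereal_uminus_less_reorder)
      ultimately show False
        using knockoff_threshold_pos[of m \<alpha> v] by (auto dest: order.strict_trans1)
    qed
    then show ?thesis by blast
  qed
  have "R \<in> closed_knockoffs m \<alpha> v \<longleftrightarrow>
    R \<subseteq> {1..m} \<and> R \<subseteq> A \<and> real (card R) / (1 + real (card D)) \<ge> 1 / \<alpha>" (is "?L \<longleftrightarrow> ?Q")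
  proof
    assume ?L
    then have R: "R \<subseteq> {1..m}" by (simp add: closed_knockoffs_def)
    have le: "FDP S R / \<alpha> \<le> local_evalue m \<alpha> v S" if "S \<subseteq> {1..m}" for S
      using \<open>?L\<close> that by (simp add: closed_knockoffs_def)
    have R0: "card R > 0"
      using assms(2) finite_subset[OF R] by (simp add: card_gt_0_iff)
    have RA: "R \<subseteq> A"
    proof
      fix i assume i: "i \<in> R"
      then have sub: "{i} \<subseteq> {1..m}" using R by blast
      \<comment> \<open>The e-value of \<open>{i}\<close> has numerator 0 unless
        \<open>i \<in> A\<close>, so a positive lower bound forces membership.\<close>
      have "0 < FDP {i} R / \<alpha>" using i assms(1) by (simp add: FDP_def)
      also have "\<dots> \<le> local_evalue m \<alpha> v {i}" using le[OF sub] .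
      finally show "i \<in> A" unfolding e[OF sub] by (cases "i \<in> A") simp_all
    qed
    \<comment> \<open>Adding \<open>D\<close> to \<open>R\<close> keeps the FDP at 1 and, as
      \<open>A\<close> and \<open>B\<close> are disjoint, leaves the numerator of the e-value at
      \<open>card R\<close> while raising its denominator to the largest possible value.\<close>
    have sub: "R \<union> D \<subseteq> {1..m}" using R by (auto simp: D_def)
    have "FDP (R \<union> D) R = 1" using R0 by (simp add: FDP_def Int_absorb2)
    moreover have "(R \<union> D) \<inter> A = R" "(R \<union> D) \<inter> B = D"
      using RA R disj by (auto simp: D_def)
    ultimately have "1 / \<alpha> \<le> real (card R) / (1 + real (card D))"
      using le[OF sub] e[OF sub] by simp
    then show ?Q using R RA by blast
  next
    assume Q: ?Q
    then have R: "R \<subseteq> {1..m}" and RA: "R \<subseteq> A" by auto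
    have R0: "card R > 0"
      using assms(2) finite_subset[OF R] by (simp add: card_gt_0_iff)
    \<comment> \<open>The ratio condition, cross-multiplied; it will bound the denominator of every
      local e-value at once.\<close>
    have key: "1 + real (card D) \<le> \<alpha> * real (card R)"
      using Q assms(1) by (simp add: field_simps)
    have "FDP S R / \<alpha> \<le> local_evalue m \<alpha> v S" if S: "S \<subseteq> {1..m}" for S
    proof -
      have fin: "finite S" using S finite_subset by blast
      have "FDP S R / \<alpha> = real (card (R \<inter> S)) / (\<alpha> * real (card R))"
        using R0 by (simp add: FDP_def max_def)
      also have "\<dots> \<le> real (card (S \<inter> A)) / (1 + real (card (S \<inter> B)))"
      \<comment> \<open>Numerators and denominators compare separately:
        \<open>R \<subseteq> A\<close> handles the former, \<open>S \<inter> B \<subseteq> D\<close>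
        together with \<open>key\<close> the latter.\<close>
      proof (rule frac_le)
        show "real (card (R \<inter> S)) \<le> real (card (S \<inter> A))"
          using RA fin by (intro of_nat_mono card_mono) auto
        have "card (S \<inter> B) \<le> card D"
          using S by (intro card_mono) (auto simp: D_def)
        then show "1 + real (card (S \<inter> B)) \<le> \<alpha> * real (card R)" using key by linarith
      qed auto
      finally show ?thesis using e[OF S] by simp
    qed
    then show ?L using R by (simp add: closed_knockoffs_def)
  qed
  then show ?thesis unfolding A_def B_def D_def by blast
qed

text \<open>The maximum with 1 in the denominator makes \<open>FDP S {}\<close> equal to 0, and
  local e-values are nonnegative.\<close>

lemma empty_in_closed_knockoffs: "{} \<in> closed_knockoffs m \<alpha> v"
  by (auto simp: closed_knockoffs_def FDP_def local_evalue_def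
      intro!: divide_nonneg_nonneg add_nonneg_nonneg sum_nonneg)

theorem theorem38:
  fixes \<Omega> :: "'a measure" and M :: "'a measure set"
    and m :: nat and H :: "nat \<Rightarrow> 'a measure set"
    and w :: "nat \<Rightarrow> 'a \<Rightarrow> real" and \<alpha> :: real
  assumes "\<And>P. P \<in> M \<Longrightarrow> prob_space P \<and> sets P = sets \<Omega>"
    and "m \<ge> 1"
    and "\<And>i. i \<in> {1..m} \<Longrightarrow> H i \<subseteq> M"
    and "\<And>i. i \<in> {1..m} \<Longrightarrow> w i \<in> borel_measurable \<Omega>"
    and "null_sign_flip M m H w"
    and "\<alpha> > 0"
  shows "\<forall>\<omega>\<in>space \<Omega>.
    closed_knockoffs m \<alpha> (\<lambda>i. w i \<omega>) =
      {R. R \<subseteq> {1..m} \<and>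
          (\<forall>i\<in>R. ereal (w i \<omega>) \<ge> knockoff_threshold m \<alpha> (\<lambda>i. w i \<omega>)) \<and>
          real (card R) /
            (1 + (\<Sum>j\<in>{1..m}. of_bool (ereal (w j \<omega>) \<le> - knockoff_threshold m \<alpha> (\<lambda>i. w i \<omega>))))
            \<ge> 1 / \<alpha>} \<union> {{}}"
proof (intro ballI set_eqI)
  fix \<omega> R
  show "R \<in> closed_knockoffs m \<alpha> (\<lambda>i. w i \<omega>) \<longleftrightarrow>
      R \<in> {R. R \<subseteq> {1..m} \<and>
          (\<forall>i\<in>R. ereal (w i \<omega>) \<ge> knockoff_threshold m \<alpha> (\<lambda>i. w i \<omega>)) \<and>
          real (card R) /
            (1 + (\<Sum>j\<in>{1..m}. of_bool (ereal (w j \<omega>) \<le> - knockoff_threshold m \<alpha> (\<lambda>i. w i \<omega>))))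
            \<ge> 1 / \<alpha>} \<union> {{}}"
    using closed_knockoffs_iff[OF \<open>\<alpha> > 0\<close>, of R m "\<lambda>i. w i \<omega>"]
      empty_in_closed_knockoffs[of m \<alpha> "\<lambda>i. w i \<omega>"]
    by (cases "R = {}") simp_all
qed

end
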